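(* Let $Y$ be a pointed topological space containing more than one point, and let $X$ be a topological space containing an isolated point. The following conditions are equivalent: (1) the function space $C_k'(X,Y)$ is complete-metrizable; (2) the spaces $Y$ and $C_k'(X,2)$ are complete-metrizable, where $2=\{0,1\}$ is the discrete two-point space with distinguished point $0$; (3) the space $Y$ is complete-metrizable and $X$ is a $\dot\kappa_\omega$-space.
   Context: A point $x\in X$ is isolated if $\{x\}$ is clopen in $X$; $\dot X$ is the set of isolated points of $X$ and $X'=X\setminus\dot X$. A pointed space is a topological space $Y$ with a distinguished point $*_Y$. $C_k(X,Y)$ is the space of continuous functions $X\to Y$ with the compact-open topology (subbase: $\{f:f(K)\subset U\}$, $K\subset X$ compact, $U\subset Y$ open), and $C_k'(X,Y)=\{f\in C_k(X,Y):f(X')\subset\{*_Y\}\}$ with the subspace topology. A space is complete-metrizable if it is homeomorphic to a complete metric space. $X$ is a $\dot\kappa_\omega$-space if there is a countable family $\{K_n\}_{n\in\omega}$ of compact subsets of $X$ such that $\dot X\subset\bigcup_{n\in\omega}K_n$ and for any set $D\subset\dot X$ that is not closed in $X$ there is $n\in\omega$ such that $D\cap K_n$ is infinite. *)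

theory Defs
  imports "HOL-Analysis.Analysis"
begin

definition isolated_points :: "'a topology \<Rightarrow> 'a set" where
  "isolated_points X = {x \<in> topspace X. openin X {x} \<and> closedin X {x}}"

definition nonisolated_points :: "'a topology \<Rightarrow> 'a set" where
  "nonisolated_points X = topspace X - isolated_points X"

text \<open>As in \<open>product_topology\<close>, a function between the spaces is represented by a unique
  HOL function, extensional on the carrier of \<open>X\<close>.\<close>

definition continuous_functions :: "'a topology \<Rightarrow> 'b topology \<Rightarrow> ('a \<Rightarrow> 'b) set" where
  "continuous_functions X Y = {f \<in> extensional (topspace X). continuous_map X Y f}"

text \<open>Compactness does not include the Hausdorff property. The choice \<open>K = {}\<close> shows that the
  carrier of the generated topology is all of \<^term>\<open>continuous_functions X Y\<close>.\<close>

definition compact_open_topology :: "'a topology \<Rightarrow> 'b topology \<Rightarrow> ('a \<Rightarrow> 'b) topology" where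
  "compact_open_topology X Y = topology_generated_by
     {{f \<in> continuous_functions X Y. f ` K \<subseteq> U} | K U. compactin X K \<and> openin Y U}"

lemma topspace_compact_open_topology:
  "topspace (compact_open_topology X Y) = continuous_functions X Y"
proof -
  have "continuous_functions X Y
      \<in> {{f \<in> continuous_functions X Y. f ` K \<subseteq> U} | K U. compactin X K \<and> openin Y U}"
    by (rule CollectI, rule exI[of _ "{}"], rule exI[of _ "{}"]) auto
  then show ?thesis
    unfolding compact_open_topology_def topology_generated_by_topspace by blast
qed

text \<open>The pointed space is given by the pair of \<open>Y\<close> and its distinguished point \<open>y0\<close>.\<close>

definition Ck' :: "'a topology \<Rightarrow> 'b topology \<Rightarrow> 'b \<Rightarrow> ('a \<Rightarrow> 'b) topology" where
  "Ck' X Y y0 =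
     subtopology (compact_open_topology X Y) {f. f ` nonisolated_points X \<subseteq> {y0}}"

definition dot_kappa_omega_space :: "'a topology \<Rightarrow> bool" where
  "dot_kappa_omega_space X \<longleftrightarrow>
     (\<exists>K :: nat \<Rightarrow> 'a set.
        (\<forall>n. compactin X (K n)) \<and>
        isolated_points X \<subseteq> (\<Union>n. K n) \<and>
        (\<forall>D. D \<subseteq> isolated_points X \<and> \<not> closedin X D \<longrightarrow> (\<exists>n. infinite (D \<inter> K n))))"

end

theory Submission
  imports Defs
begin

text \<open>All three conditions reduce to one equivalence, applied to \<open>Y\<close> and to the two-point space:
  \<open>Ck' X Y y0\<close> is completely metrizable iff \<open>Y\<close> is and
  \<open>dot_kappa_omega_space X\<close> holds.

  If the compact sets \<open>K n\<close> witness the latter and \<open>n(x)\<close> is the least \<open>n\<close> with \<open>x \<in> K n\<close>, then the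
  supremum over isolated \<open>x\<close> of \<open>min (1 / (n(x) + 1)) (d (f x) (g x))\<close> is a complete metric inducing the
  compact-open topology, because the isolated points of any compact set are covered by finitely many
  \<open>K n\<close>.

  Conversely, \<open>Y\<close> is a retract of \<open>Ck' X Y y0\<close>, and balls around the constant function yield the \<open>K n\<close>.
  Let \<open>D\<close> be a set of isolated points meeting every \<open>K n\<close> in a finite set. Completeness replaces the
  Baire category argument for the group of closed sets of isolated points: one builds two Cauchy
  sequences of characteristic functions of finite subsets of \<open>D\<close> whose limits are characteristic
  functions of sets with union \<open>D\<close>, so \<open>D\<close> is closed.\<close>

section \<open>Sets of isolated points\<close>

lemma isolated_points_subset_topspace: "isolated_points X \<subseteq> topspace X"
  by (auto simp: isolated_points_def)

lemma openin_isolated_subset: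
  assumes "D \<subseteq> isolated_points X"
  shows "openin X D"
proof -
  have "openin X (\<Union>x\<in>D. {x})"
    using assms by (intro openin_Union) (auto simp: isolated_points_def)
  then show ?thesis by simp
qed

lemma closedin_finite_isolated:
  assumes "finite D" "D \<subseteq> isolated_points X"
  shows "closedin X D"
proof -
  have "closedin X (\<Union>x\<in>D. {x})"
    using assms by (intro closedin_Union) (auto simp: isolated_points_def)
  then show ?thesis by simp
qed

text \<open>A closed part of a compact set is compact, and an infinite compact set contains an
  accumulation point of itself, which cannot be isolated.\<close>

lemma finite_isolated_Int_compact:
  assumes "closedin X D" "D \<subseteq> isolated_points X" "compactin X K"
  shows "finite (D \<inter> K)"
proof (rule ccontr)
  assume "infinite (D \<inter> K)"
  moreover have "compactin X (D \<inter> K)"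
    using assms by (simp add: closed_Int_compactin)
  ultimately obtain a where "a \<in> D \<inter> K" "a \<in> X derived_set_of (D \<inter> K)"
    using compactin_imp_Bolzano_Weierstrass[of X "D \<inter> K" "D \<inter> K"] by auto
  then show False
    using assms by (auto simp: in_derived_set_of isolated_points_def)
qed

section \<open>The points and the topology of \<open>Ck'\<close>\<close>

lemma topspace_Ck':
  assumes "y0 \<in> topspace Y"
  shows "f \<in> topspace (Ck' X Y y0) \<longleftrightarrow>
     f \<in> extensional (topspace X) \<and> f \<in> topspace X \<rightarrow> topspace Y \<and>
     (\<forall>x \<in> nonisolated_points X. f x = y0) \<and>
     (\<forall>U. openin Y U \<and> y0 \<in> U \<longrightarrow> closedin X {x \<in> isolated_points X. f x \<notin> U})"
    (is "?L \<longleftrightarrow> ?R")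
proof
  assume ?L
  then have ext: "f \<in> extensional (topspace X)" and cont: "continuous_map X Y f"
    and 0: "\<And>x. x \<in> nonisolated_points X \<Longrightarrow> f x = y0"
    by (auto simp: Ck'_def topspace_compact_open_topology continuous_functions_def)
  have "closedin X {x \<in> isolated_points X. f x \<notin> U}" if "openin Y U" "y0 \<in> U" for U
  proof -
    have "{x \<in> topspace X. f x \<in> topspace Y - U} = {x \<in> isolated_points X. f x \<notin> U}"
      using 0 that cont
      by (force simp: nonisolated_points_def isolated_points_def continuous_map_def)
    moreover have "closedin X {x \<in> topspace X. f x \<in> topspace Y - U}"
      using cont that by (intro closedin_continuous_map_preimage) auto
    ultimately show ?thesis by simp
  qed
  then show ?R
    using ext 0 cont by (auto simp: continuous_map_def)
next
  assume R: ?R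
  \<comment> \<open>Every set of isolated points is open, so continuity is a condition only at
    neighbourhoods of \<open>y0\<close>, whose preimages are the complements of the sets assumed
    closed.\<close>
  have "openin X {x \<in> topspace X. f x \<in> U}" if U: "openin Y U" for U
  proof (cases "y0 \<in> U")
    case True
    then have "openin X (topspace X - {x \<in> isolated_points X. f x \<notin> U})"
      using R U by auto
    moreover have "topspace X - {x \<in> isolated_points X. f x \<notin> U} = {x \<in> topspace X. f x \<in> U}"
      using R True by (auto simp: nonisolated_points_def)
    ultimately show ?thesis by simp
  next
    case False
    then show ?thesis
      using R by (intro openin_isolated_subset) (auto simp: nonisolated_points_def)
  qed
  then have "continuous_map X Y f"
    using R by (auto simp: continuous_map_def)
  then show ?L
    using R by (auto simp: Ck'_def topspace_compact_open_topology continuous_functions_def)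
qed

lemma openin_Ck'_subbase:
  assumes "compactin X K" "openin Y U"
  shows "openin (Ck' X Y y0) {f \<in> topspace (Ck' X Y y0). f ` K \<subseteq> U}"
proof -
  have "openin (compact_open_topology X Y) {f \<in> continuous_functions X Y. f ` K \<subseteq> U}"
    unfolding compact_open_topology_def
    by (rule topology_generated_by_Basis) (use assms in blast)
  then show ?thesis
    unfolding Ck'_def openin_subtopology
    by (intro exI[of _ "{f \<in> continuous_functions X Y. f ` K \<subseteq> U}"])
       (auto simp: topspace_compact_open_topology)
qed

lemma continuous_map_into_Ck':
  assumes "h \<in> topspace Z \<rightarrow> topspace (Ck' X Y y0)"
    and "\<And>K U. compactin X K \<Longrightarrow> openin Y U \<Longrightarrow> openin Z {z \<in> topspace Z. h z ` K \<subseteq> U}"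
  shows "continuous_map Z (Ck' X Y y0) h"
proof -
  have h: "h z \<in> continuous_functions X Y" "h z ` nonisolated_points X \<subseteq> {y0}"
    if "z \<in> topspace Z" for z
    using assms(1) that by (auto simp: Ck'_def topspace_compact_open_topology)
  have "continuous_map Z (compact_open_topology X Y) h"
    unfolding compact_open_topology_def
  proof (rule continuous_on_generated_topo)
    fix S assume "S \<in> {{f \<in> continuous_functions X Y. f ` K \<subseteq> U} | K U. compactin X K \<and> openin Y U}"
    then obtain K U where KU: "compactin X K" "openin Y U"
      and S: "S = {f \<in> continuous_functions X Y. f ` K \<subseteq> U}"
      by blast
    have "h -` S \<inter> topspace Z = {z \<in> topspace Z. h z ` K \<subseteq> U}"
      using h unfolding S by blast
    then show "openin Z (h -` S \<inter> topspace Z)"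
      using assms(2)[OF KU] by simp
  next
    have "h ` topspace Z \<subseteq> topspace (compact_open_topology X Y)"
      using h by (auto simp: topspace_compact_open_topology)
    then show "h ` topspace Z \<subseteq> \<Union> {{f \<in> continuous_functions X Y. f ` K \<subseteq> U} | K U. compactin X K \<and> openin Y U}"
      unfolding compact_open_topology_def topology_generated_by_topspace .
  qed
  then show ?thesis
    using h(2) by (auto simp: Ck'_def continuous_map_in_subtopology)
qed

lemma continuous_map_Ck'_eval:
  assumes "x \<in> topspace X"
  shows "continuous_map (Ck' X Y y0) Y (\<lambda>f. f x)"
proof -
  have "f x \<in> topspace Y" if "f \<in> topspace (Ck' X Y y0)" for f
    using assms that
    by (auto simp: Ck'_def topspace_compact_open_topology continuous_functions_def continuous_map_def)
  moreover have "openin (Ck' X Y y0) {f \<in> topspace (Ck' X Y y0). f x \<in> U}" if "openin Y U" for U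
    using openin_Ck'_subbase[of X "{x}" Y U y0] assms that by simp
  ultimately show ?thesis
    by (auto simp: continuous_map_def)
qed

text \<open>Induction over the generation of open sets: a finite intersection unites the compact
  sets, a union keeps that of one member. Exact agreement on \<open>K\<close>, rather than
  closeness, suffices because only two-valued functions will be compared.\<close>

lemma Ck'_open_contains_cylinder:
  assumes "openin (Ck' X Y y0) W" "f \<in> W"
  shows "\<exists>K. compactin X K \<and>
    (\<forall>g \<in> topspace (Ck' X Y y0). (\<forall>x \<in> K. g x = f x) \<longrightarrow> g \<in> W)"
proof -
  obtain V where V: "openin (compact_open_topology X Y) V"
    and W: "W = V \<inter> {f. f ` nonisolated_points X \<subseteq> {y0}}"
    using assms by (auto simp: Ck'_def openin_subtopology)
  have "generate_topology_on
     {{f \<in> continuous_functions X Y. f ` K \<subseteq> U} | K U. compactin X K \<and> openin Y U} V"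
    using V unfolding compact_open_topology_def by (rule openin_topology_generated_by)
  moreover have "f \<in> V"
    using assms(2) W by blast
  ultimately have "\<exists>K. compactin X K \<and>
     (\<forall>g \<in> continuous_functions X Y. (\<forall>x \<in> K. g x = f x) \<longrightarrow> g \<in> V)"
  proof induction
    case (Int a b)
    then obtain K L where "compactin X K" "compactin X L"
      "\<forall>g \<in> continuous_functions X Y. (\<forall>x \<in> K. g x = f x) \<longrightarrow> g \<in> a"
      "\<forall>g \<in> continuous_functions X Y. (\<forall>x \<in> L. g x = f x) \<longrightarrow> g \<in> b"
      by blast
    then show ?case
      by (intro exI[of _ "K \<union> L"]) (auto simp: compactin_Un)
  next
    case (UN \<K>)
    then show ?case by (meson Union_iff)
  next
    case (Basis s)
    then obtain K U where "compactin X K" "s = {f \<in> continuous_functions X Y. f ` K \<subseteq> U}"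
      by blast
    then show ?case
      using Basis by (intro exI[of _ K]) force
  qed simp
  then obtain K where K: "compactin X K"
    "\<forall>g \<in> continuous_functions X Y. (\<forall>x \<in> K. g x = f x) \<longrightarrow> g \<in> V"
    by blast
  then show ?thesis
    by (intro exI[of _ K]) (auto simp: W Ck'_def topspace_compact_open_topology)
qed

section \<open>Two-valued functions and the retraction onto \<open>Y\<close>\<close>

definition two_valued :: "'a topology \<Rightarrow> 'b \<Rightarrow> 'b \<Rightarrow> 'a set \<Rightarrow> 'a \<Rightarrow> 'b" where
  "two_valued X y0 b C = (\<lambda>x \<in> topspace X. if x \<in> C then b else y0)"

lemma two_valued_in_Ck':
  assumes "y0 \<in> topspace Y" "b \<in> topspace Y" "finite C" "C \<subseteq> isolated_points X"
  shows "two_valued X y0 b C \<in> topspace (Ck' X Y y0)"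
proof -
  have "closedin X {x \<in> isolated_points X. two_valued X y0 b C x \<notin> U}" if "y0 \<in> U" for U
  proof (rule closedin_finite_isolated)
    have "{x \<in> isolated_points X. two_valued X y0 b C x \<notin> U} \<subseteq> C"
      using that isolated_points_subset_topspace[of X] by (auto simp: two_valued_def)
    then show "finite {x \<in> isolated_points X. two_valued X y0 b C x \<notin> U}"
      using assms(3) finite_subset by blast
  qed auto
  then show ?thesis
    unfolding topspace_Ck'[OF assms(1)]
    using assms by (auto simp: two_valued_def nonisolated_points_def)
qed

text \<open>The section sends \<open>y\<close> to the function with value \<open>y\<close> at
  \<open>a\<close> and \<open>y0\<close> elsewhere. Through this retraction \<open>Y\<close> will
  inherit complete metrizability.\<close>

lemma retraction_map_Ck'_eval:
  assumes y0: "y0 \<in> topspace Y" and a: "a \<in> isolated_points X"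
  shows "retraction_map (Ck' X Y y0) Y (\<lambda>f. f a)"
proof -
  have aX: "a \<in> topspace X"
    using a isolated_points_subset_topspace[of X] by blast
  let ?e = "\<lambda>y. two_valued X y0 y {a}"
  have "continuous_map Y (Ck' X Y y0) ?e"
  proof (rule continuous_map_into_Ck')
    show "?e \<in> topspace Y \<rightarrow> topspace (Ck' X Y y0)"
      using a y0 by (auto intro: two_valued_in_Ck')
    fix K U assume K: "compactin X K" and U: "openin Y U"
    have "K \<subseteq> topspace X"
      using K compactin_subset_topspace by blast
    then have "?e y ` K \<subseteq> U \<longleftrightarrow> (a \<in> K \<longrightarrow> y \<in> U) \<and> (K - {a} \<noteq> {} \<longrightarrow> y0 \<in> U)" for y
      by (auto simp: two_valued_def image_subset_iff split: if_splits)
    \<comment> \<open>The set \<open>K\<close> sees \<open>y\<close> only if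
      \<open>a \<in> K\<close>, and sees \<open>y0\<close> only if it has a point other than
      \<open>a\<close>.\<close>
    then have "{y \<in> topspace Y. ?e y ` K \<subseteq> U} =
      (if K - {a} \<noteq> {} \<and> y0 \<notin> U then {} else if a \<in> K then U else topspace Y)"
      using openin_subset[OF U] by auto
    then show "openin Y {y \<in> topspace Y. ?e y ` K \<subseteq> U}"
      using U by auto
  qed
  then show ?thesis
    unfolding retraction_map_def retraction_maps_def
    using continuous_map_Ck'_eval[OF aX, of Y y0] aX
    by (intro exI[of _ ?e]) (auto simp: two_valued_def)
qed

section \<open>From a complete metric to the compact sets \<open>K n\<close>\<close>

lemma (in Metric_space) MCauchy_geometric:
  assumes M: "\<And>n. \<sigma> n \<in> M" and step: "\<And>n. d (\<sigma> n) (\<sigma> (Suc n)) \<le> (1/2) ^ n"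
  shows "MCauchy \<sigma>"
proof -
  \<comment> \<open>The bound is the exact sum of \<open>(1/2) ^ i\<close> for \<open>i\<close> from
    \<open>n\<close> to \<open>n + k - 1\<close>, a form that passes through the induction.\<close>
  have *: "d (\<sigma> n) (\<sigma> (n + k)) \<le> 2 * (1/2) ^ n - 2 * (1/2) ^ (n + k)" for n k
  proof (induction k)
    case (Suc k)
    have "d (\<sigma> n) (\<sigma> (n + Suc k)) \<le> d (\<sigma> n) (\<sigma> (n + k)) + d (\<sigma> (n + k)) (\<sigma> (n + Suc k))"
      using M triangle by blast
    also have "\<dots> \<le> 2 * (1/2) ^ n - 2 * (1/2) ^ (n + k) + (1/2) ^ (n + k)"
      using Suc step[of "n + k"] by simp
    finally show ?case by simp
  qed (simp add: M)
  have le: "d (\<sigma> n) (\<sigma> m) \<le> 2 * (1/2) ^ N" if "N \<le> n" "n \<le> m" for N n m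
  proof -
    have "d (\<sigma> n) (\<sigma> m) \<le> 2 * (1/2) ^ n"
      using *[of n "m - n"] that by (smt (verit) le_add_diff_inverse zero_le_power divide_nonneg_pos)
    also have "\<dots> \<le> 2 * (1/2) ^ N"
      using that by (simp add: power_decreasing)
    finally show ?thesis .
  qed
  show ?thesis
    unfolding MCauchy_def
  proof (intro conjI allI impI)
    fix e :: real assume "e > 0"
    then obtain N where N: "(1/2) ^ N < e / 2"
      using real_arch_pow_inv[of "e/2" "1/2"] by auto
    have "d (\<sigma> n) (\<sigma> m) < e" if "N \<le> n" "N \<le> m" for n m
      using le[of N n m] le[of N m n] N that commute[of "\<sigma> n" "\<sigma> m"] by linarith
    then show "\<exists>N. \<forall>n m. N \<le> n \<longrightarrow> N \<le> m \<longrightarrow> d (\<sigma> n) (\<sigma> m) < e"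
      by blast
  qed (use M in auto)
qed

text \<open>The Hausdorff property separates \<open>b\<close> from \<open>y0\<close>, makes
  pointwise limits unique, and makes \<open>{b}\<close> and hence its preimages closed.\<close>

lemma completely_metrizable_Ck'_imp_dot_kappa_omega:
  assumes cm: "completely_metrizable_space (Ck' X Y y0)" and Y: "Hausdorff_space Y"
    and y0: "y0 \<in> topspace Y" and b: "b \<in> topspace Y" "b \<noteq> y0"
  shows "dot_kappa_omega_space X"
proof -
  obtain M d where "Metric_space M d" and complete: "Metric_space.mcomplete M d"
    and top: "Ck' X Y y0 = Metric_space.mtopology M d"
    using cm unfolding completely_metrizable_space_def by blast
  then interpret Metric_space M d by simp
  let ?I = "isolated_points X"
  let ?c = "two_valued X y0 b"
  have M: "topspace (Ck' X Y y0) = M"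
    by (simp add: top)
  have cM: "?c C \<in> M" if "finite C" "C \<subseteq> ?I" for C
    using two_valued_in_Ck'[OF y0 b(1) that] M by simp
  have IX: "?I \<subseteq> topspace X"
    by (rule isolated_points_subset_topspace)
  have "\<exists>K. compactin X K \<and> (\<forall>g \<in> M. (\<forall>x \<in> K. g x = f x) \<longrightarrow> d f g < e)"
    if "f \<in> M" "e > 0" for f e
  proof -
    have "openin (Ck' X Y y0) (mball f e)" "f \<in> mball f e"
      using that by (auto simp: top)
    then obtain K where "compactin X K"
      "\<forall>g \<in> M. (\<forall>x \<in> K. g x = f x) \<longrightarrow> g \<in> mball f e"
      using Ck'_open_contains_cylinder[of X Y y0 "mball f e" f] unfolding M by blast
    then show ?thesis
      by (intro exI[of _ K]) auto
  qed
  then have "\<forall>f e. \<exists>K. f \<in> M \<and> e > 0 \<longrightarrow>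
      compactin X K \<and> (\<forall>g \<in> M. (\<forall>x \<in> K. g x = f x) \<longrightarrow> d f g < e)"
    by blast
  \<comment> \<open>The metric \<open>d\<close> is arbitrary; \<open>Q f e\<close> is a compact set
    on which agreement with \<open>f\<close> forces distance less than \<open>e\<close>.\<close>
  then obtain Q where Q': "\<And>f e. f \<in> M \<and> e > 0 \<longrightarrow>
      compactin X (Q f e) \<and> (\<forall>g \<in> M. (\<forall>x \<in> Q f e. g x = f x) \<longrightarrow> d f g < e)"
    unfolding choice_iff by blast
  have Q: "compactin X (Q f e)" if "f \<in> M" "e > 0" for f e
    using Q' that by blast
  have Qd: "d f g < e" if "f \<in> M" "e > 0" "g \<in> M" "\<And>x. x \<in> Q f e \<Longrightarrow> g x = f x" for f e g
    using Q' that by blast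
  define K where "K n = Q (?c {}) (1 / real (Suc n))" for n
  have K: "compactin X (K n)" for n
    unfolding K_def by (intro Q cM) auto
  \<comment> \<open>If an isolated \<open>x \<in> L\<close> lay outside \<open>K n\<close>, then
    \<open>?c {x}\<close> would agree with \<open>?c {}\<close> on \<open>K n\<close> and so be
    close to it. But \<open>?c {x}\<close> takes the value \<open>b\<close> on \<open>L\<close>,
    which the neighbourhood \<open>W\<close> of \<open>?c {}\<close> forbids.\<close>
  have absorb: "\<exists>n. L \<inter> ?I \<subseteq> K n" if L: "compactin X L" for L
  proof -
    obtain U where U: "openin Y U" "y0 \<in> U" "b \<notin> U"
      using Y y0 b by (metis Hausdorff_space_def disjnt_iff)
    define W where "W = {f \<in> topspace (Ck' X Y y0). f ` L \<subseteq> U}"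
    have "?c {} \<in> W"
      using cM[of "{}"] U compactin_subset_topspace[OF L]
      by (auto simp: W_def M two_valued_def image_subset_iff)
    moreover have "openin mtopology W"
      unfolding W_def top[symmetric] by (rule openin_Ck'_subbase[OF L U(1)])
    ultimately obtain r where r: "r > 0" "mball (?c {}) r \<subseteq> W"
      unfolding openin_mtopology by blast
    obtain n where n: "1 / real (Suc n) < r"
      using nat_approx_posE[OF r(1)] by blast
    have "x \<in> K n" if x: "x \<in> L" "x \<in> ?I" for x
    proof (rule ccontr)
      assume "x \<notin> K n"
      then have "d (?c {}) (?c {x}) < 1 / real (Suc n)"
        using x unfolding K_def by (intro Qd cM) (auto simp: two_valued_def)
      then have "?c {x} \<in> W"
        using r n x cM[of "{}"] cM[of "{x}"] by (auto simp: subset_iff)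
      then have "?c {x} x \<in> U"
        using x by (auto simp: W_def)
      then show False
        using U x IX by (auto simp: two_valued_def)
    qed
    then show ?thesis by blast
  qed
  have closedD: "closedin X D" if D: "D \<subseteq> ?I" and fin: "\<And>n. finite (D \<inter> K n)" for D
  proof -
    have finL: "finite (D \<inter> L)" if L: "compactin X L" for L
    proof -
      obtain n where "L \<inter> ?I \<subseteq> K n" using absorb[OF L] by blast
      then have "D \<inter> L \<subseteq> D \<inter> K n" using D by blast
      then show ?thesis using fin finite_subset by blast
    qed
    \<comment> \<open>Each compact set \<open>P n\<close> is chosen after \<open>C n\<close>, and since \<open>C (n + 2) \<inter> P n = C n \<inter> P n\<close>,
      the terms of even and of odd index form two Cauchy sequences, while
      \<open>C n \<union> C (Suc n) \<supseteq> D \<inter> P n\<close>.\<close>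
    define S where "S = rec_nat ({}, K 0 \<union> Q (?c {}) 1)
      (\<lambda>n s. let C = (D \<inter> snd s) - fst s in (C, snd s \<union> K (Suc n) \<union> Q (?c C) ((1/2) ^ Suc n)))"
    define C where "C = fst \<circ> S"
    define P where "P = snd \<circ> S"
    have C0: "C 0 = {}" and P0: "P 0 = K 0 \<union> Q (?c {}) 1"
      and C_Suc: "\<And>n. C (Suc n) = D \<inter> P n - C n"
      and P_Suc: "\<And>n. P (Suc n) = P n \<union> K (Suc n) \<union> Q (?c (C (Suc n))) ((1/2) ^ Suc n)"
      by (simp_all add: C_def P_def S_def Let_def)
    \<comment> \<open>The claims support each other: finiteness of \<open>C n\<close> puts
      \<open>?c (C n)\<close> into \<open>M\<close>, so that \<open>Q\<close> yields a compact set,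
      and compactness of \<open>P n\<close> makes \<open>C (Suc n)\<close> finite by
      \<open>finL\<close>.\<close>
    have inv: "C n \<subseteq> D \<and> finite (C n) \<and> compactin X (P n)" for n
    proof (induction n)
      case 0
      then show ?case
        using cM by (auto simp: C0 P0 intro!: compactin_Un K Q)
    next
      case (Suc n)
      then have "C (Suc n) \<subseteq> D" "finite (C (Suc n))"
        using finL by (auto simp: C_Suc)
      with Suc show ?case
        using D by (auto simp: P_Suc intro!: compactin_Un K Q cM)
    qed
    have CM: "?c (C n) \<in> M" for n
      using inv D by (intro cM) auto
    \<comment> \<open>The \<open>Q\<close> part makes changes off \<open>P n\<close> small; the
      \<open>K\<close> part makes the \<open>P n\<close> exhaust the isolated points.\<close>
    have QP: "Q (?c (C n)) ((1/2) ^ n) \<subseteq> P n" and KP: "K n \<subseteq> P n" for n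
      by (cases n; simp add: C0 P0 P_Suc; blast)+
    have P_mono: "P m \<subseteq> P n" if "m \<le> n" for m n
      using that by (rule lift_Suc_mono_le[rotated]) (auto simp: P_Suc)
    \<comment> \<open>A point of \<open>D\<close> in \<open>P n\<close> changes membership at each
      of the two steps and so returns; a point outside \<open>D\<close> is never a member.\<close>
    have C_eq: "x \<in> C (n + 2) \<longleftrightarrow> x \<in> C n" if "x \<in> P n" for x n
      using that inv[of n] by (auto simp: C_Suc P_Suc)
    have step: "d (?c (C n)) (?c (C (n + 2))) < (1/2) ^ n" for n
    proof (rule Qd)
      fix x assume "x \<in> Q (?c (C n)) ((1/2) ^ n)"
      then have "x \<in> P n" using QP by blast
      then show "?c (C (n + 2)) x = ?c (C n) x"
        using C_eq by (simp add: two_valued_def)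
    qed (use CM in auto)
    have lim: "\<exists>f \<in> M. \<forall>x \<in> ?I. \<exists>N. \<forall>n \<ge> N. f x = ?c (C (2 * n + i)) x" for i
    proof -
      define \<sigma> where "\<sigma> n = ?c (C (2 * n + i))" for n
      have "MCauchy \<sigma>"
      proof (rule MCauchy_geometric)
        fix n
        have "d (\<sigma> n) (\<sigma> (Suc n)) \<le> (1/2) ^ (2 * n + i)"
          using step[of "2 * n + i"] by (simp add: \<sigma>_def)
        also have "\<dots> \<le> (1/2) ^ n"
          by (rule power_decreasing) auto
        finally show "d (\<sigma> n) (\<sigma> (Suc n)) \<le> (1/2) ^ n" .
      qed (simp add: \<sigma>_def CM)
      then obtain f where f: "limitin mtopology \<sigma> f sequentially"
        using complete mcomplete_def by blast
      \<comment> \<open>Once \<open>x\<close> has entered \<open>P\<close>, the values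
        \<open>\<sigma> n x\<close> stay fixed by \<open>C_eq\<close>, and continuity of evaluation
        at \<open>x\<close> gives the limit this value.\<close>
      have "\<exists>N. \<forall>n \<ge> N. f x = \<sigma> n x" if x: "x \<in> ?I" for x
      proof -
        obtain N where "x \<in> K N"
          using absorb[of "{x}"] x IX by auto
        then have xN: "x \<in> P (2 * n + i)" if "n \<ge> N" for n
          using KP P_mono[of N "2 * n + i"] that by auto
        have const: "\<sigma> n x = \<sigma> N x" if "n \<ge> N" for n
          using that
        proof (induction n rule: dec_induct)
          case (step n)
          have "\<sigma> (Suc n) x = \<sigma> n x"
            using C_eq[OF xN[OF step(1)]] by (simp add: \<sigma>_def two_valued_def)
          then show ?case using step by simp
        qed simp
        have "limitin Y ((\<lambda>f. f x) \<circ> \<sigma>) (f x) sequentially"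
          using continuous_map_Ck'_eval[of x X Y y0] x IX f
          by (intro continuous_map_limit[where X = mtopology]) (auto simp: top)
        moreover have "limitin Y ((\<lambda>f. f x) \<circ> \<sigma>) (\<sigma> N x) sequentially"
        proof (rule limitin_eventually)
          show "\<sigma> N x \<in> topspace Y"
            using y0 b x IX by (auto simp: \<sigma>_def two_valued_def)
          show "\<forall>\<^sub>F n in sequentially. ((\<lambda>f. f x) \<circ> \<sigma>) n = \<sigma> N x"
            unfolding comp_apply by (rule eventually_sequentiallyI) (rule const)
        qed
        ultimately have "f x = \<sigma> N x"
          by (rule limitin_Hausdorff_unique) (use Y in auto)
        then have "\<forall>n \<ge> N. f x = \<sigma> n x"
          using const by metis
        then show ?thesis ..
      qed
      moreover have "f \<in> M"
        using f limitin_mspace by blast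
      ultimately show ?thesis by (auto simp: \<sigma>_def)
    qed
    obtain f where f: "f \<in> M" "\<forall>x \<in> ?I. \<exists>N. \<forall>n \<ge> N. f x = ?c (C (2 * n)) x"
      using lim[of 0] by auto
    obtain g where g: "g \<in> M" "\<forall>x \<in> ?I. \<exists>N. \<forall>n \<ge> N. g x = ?c (C (Suc (2 * n))) x"
      using lim[of 1] by auto
    have closed: "closedin X {x \<in> topspace X. h x \<in> {b}}" if "h \<in> M" for h
    proof (rule closedin_continuous_map_preimage)
      show "continuous_map X Y h"
        using that unfolding M[symmetric]
        by (auto simp: Ck'_def topspace_compact_open_topology continuous_functions_def)
      show "closedin Y {b}"
        using Y b by (simp add: closedin_Hausdorff_singleton)
    qed
    have isol: "x \<in> ?I" if "h \<in> M" "h x = b" "x \<in> topspace X" for h x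
      using that b(2) unfolding M[symmetric] topspace_Ck'[OF y0]
      by (auto simp: nonisolated_points_def)
    have sub: "x \<in> D" if "x \<in> ?I" "?c (C n) x = b" for x n
      using that inv[of n] b(2) IX by (auto simp: two_valued_def split: if_splits)
    \<comment> \<open>A point of \<open>D\<close> in \<open>P (2 * n)\<close> lies in exactly one of
      \<open>C (2 * n)\<close> and \<open>C (Suc (2 * n))\<close>, so for late \<open>n\<close> one
      of the limits \<open>f\<close>, \<open>g\<close> is \<open>b\<close> there. Conversely, a
      value \<open>b\<close> of a limit is already a value of some \<open>?c (C n)\<close> with
      \<open>C n \<subseteq> D\<close>.\<close>
    have "D = {x \<in> topspace X. f x \<in> {b}} \<union> {x \<in> topspace X. g x \<in> {b}}"
    proof (intro equalityI subsetI)
      fix x assume x: "x \<in> D"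
      then have xI: "x \<in> ?I" "x \<in> topspace X" using D IX by auto
      obtain N1 where N1: "\<forall>n \<ge> N1. f x = ?c (C (2 * n)) x"
        using f(2) xI by blast
      obtain N2 where N2: "\<forall>n \<ge> N2. g x = ?c (C (Suc (2 * n))) x"
        using g(2) xI by blast
      obtain N3 where "x \<in> K N3"
        using absorb[of "{x}"] xI by auto
      define n where "n = max N1 (max N2 N3)"
      have "N3 \<le> 2 * n"
        by (auto simp: n_def)
      then have "x \<in> P (2 * n)"
        using \<open>x \<in> K N3\<close> KP P_mono by blast
      then have "x \<in> C (2 * n) \<or> x \<in> C (Suc (2 * n))"
        using x by (auto simp: C_Suc)
      moreover have "n \<ge> N1" "n \<ge> N2"
        by (auto simp: n_def)
      ultimately have "f x = b \<or> g x = b"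
        using N1 N2 xI by (auto simp: two_valued_def)
      then show "x \<in> {x \<in> topspace X. f x \<in> {b}} \<union> {x \<in> topspace X. g x \<in> {b}}"
        using xI by auto
    next
      fix x assume "x \<in> {x \<in> topspace X. f x \<in> {b}} \<union> {x \<in> topspace X. g x \<in> {b}}"
      then consider "x \<in> topspace X" "f x = b" | "x \<in> topspace X" "g x = b" by blast
      then show "x \<in> D"
      proof cases
        case 1
        then have xI: "x \<in> ?I"
          using isol[OF f(1)] by simp
        then obtain N where "f x = ?c (C (2 * N)) x"
          using f(2) by blast
        then show ?thesis
          using sub[OF xI, of "2 * N"] 1 by simp
      next
        case 2
        then have xI: "x \<in> ?I"
          using isol[OF g(1)] by simp
        then obtain N where "g x = ?c (C (Suc (2 * N))) x"
          using g(2) by blast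
        then show ?thesis
          using sub[OF xI, of "Suc (2 * N)"] 2 by simp
      qed
    qed
    moreover have "closedin X ({x \<in> topspace X. f x \<in> {b}} \<union> {x \<in> topspace X. g x \<in> {b}})"
      using closed[OF f(1)] closed[OF g(1)] by (rule closedin_Un)
    ultimately show ?thesis by (rule ssubst)
  qed
  show ?thesis
    unfolding dot_kappa_omega_space_def
  proof (intro exI[of _ K] conjI allI impI)
    show "compactin X (K n)" for n
      by (rule K)
    show "?I \<subseteq> (\<Union>n. K n)"
    proof
      fix x assume "x \<in> ?I"
      then show "x \<in> (\<Union>n. K n)"
        using absorb[of "{x}"] IX by auto
    qed
    show "\<exists>n. infinite (D \<inter> K n)" if "D \<subseteq> ?I \<and> \<not> closedin X D" for D
      using closedD[of D] that by metis
  qed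
qed

section \<open>From the compact sets \<open>K n\<close> to the weights\<close>

lemma isolated_Int_compact_absorbed:
  assumes cover: "isolated_points X \<subseteq> (\<Union>n. K n)"
    and D: "\<And>D. D \<subseteq> isolated_points X \<Longrightarrow> \<not> closedin X D \<Longrightarrow> \<exists>n. infinite (D \<inter> K n)"
    and L: "compactin X L"
  shows "\<exists>m::nat. L \<inter> isolated_points X \<subseteq> (\<Union>n\<le>m. K n)"
proof (rule ccontr)
  assume "\<nexists>m. L \<inter> isolated_points X \<subseteq> (\<Union>n\<le>m. K n)"
  then have "\<exists>x. x \<in> L \<inter> isolated_points X - (\<Union>n\<le>m. K n)" for m
    by blast
  \<comment> \<open>Since \<open>z m\<close> avoids \<open>K 0\<close> to \<open>K m\<close>, only
    \<open>z m\<close> with \<open>m < n\<close> can lie in \<open>K n\<close>. So the range meets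
    each \<open>K n\<close> in a finite set, hence is closed, hence meets the compact
    \<open>L\<close> in a finite set.\<close>
  then obtain z where z: "\<And>m. z m \<in> L \<inter> isolated_points X - (\<Union>n\<le>m. K n)"
    by metis
  have fin: "finite (range z \<inter> K n)" for n
  proof -
    have "range z \<inter> K n \<subseteq> z ` {..<n}"
      using z by (force simp: not_less[symmetric])
    then show ?thesis
      using finite_subset by blast
  qed
  have zI: "range z \<subseteq> isolated_points X"
    using z by auto
  then have "closedin X (range z)"
    using D[of "range z"] fin by blast
  then have "finite (range z \<inter> L)"
    using finite_isolated_Int_compact L zI by blast
  moreover have "range z \<inter> L = range z"
    using z by auto
  ultimately have "finite (range z)"
    by simp
  \<comment> \<open>A finite range forces a value \<open>p\<close> with infinitely many indices, yet
    \<open>p\<close> lies in some \<open>K n\<close>, which bounds these indices by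
    \<open>n\<close>.\<close>
  then obtain p where "finite (range z)" "infinite {m. z m = p}"
    using pigeonhole_infinite[of "UNIV :: nat set" z] by auto
  obtain n where "p \<in> K n"
    using \<open>infinite {m. z m = p}\<close> not_finite_existsD[of "\<lambda>m. z m = p"] z cover by blast
  then have "{m. z m = p} \<subseteq> {..<n}"
    using z by (force simp: not_less[symmetric])
  then show False
    using \<open>infinite {m. z m = p}\<close> finite_subset by blast
qed

lemma dot_kappa_omega_imp_completely_metrizable_Ck':
  assumes Y: "completely_metrizable_space Y" and y0: "y0 \<in> topspace Y"
    and X: "dot_kappa_omega_space X" and ne: "isolated_points X \<noteq> {}"
  shows "completely_metrizable_space (Ck' X Y y0)"
proof -
  obtain M d where "Metric_space M d" and complete: "Metric_space.mcomplete M d"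
    and top: "Y = Metric_space.mtopology M d"
    using Y unfolding completely_metrizable_space_def by blast
  then interpret Metric_space M d by simp
  have y0M: "y0 \<in> M"
    using y0 top by simp
  let ?I = "isolated_points X"
  have IX: "?I \<subseteq> topspace X"
    by (rule isolated_points_subset_topspace)
  obtain K where K: "\<And>n. compactin X (K n)" and cover: "?I \<subseteq> (\<Union>n::nat. K n)"
    and D: "\<And>D. D \<subseteq> ?I \<Longrightarrow> \<not> closedin X D \<Longrightarrow> \<exists>n. infinite (D \<inter> K n)"
    using X unfolding dot_kappa_omega_space_def by blast
  \<comment> \<open>For \<open>x\<close> in no \<open>K n\<close> the \<open>LEAST\<close> is
    unspecified, but the weights are evaluated in the metric only at isolated points, which
    \<open>cover\<close> handles.\<close>
  define w where "w x = 1 / real (Suc (LEAST n. x \<in> K n))" for x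
  have w_pos: "w x > 0" and w_le: "w x \<le> 1" for x
    by (auto simp: w_def)
  have w_lower: "w x \<ge> 1 / real (Suc m)" if "x \<in> (\<Union>n\<le>m. K n)" for x m
  proof -
    have "(LEAST n. x \<in> K n) \<le> m"
      using that by (meson Least_le UN_E atMost_iff order_trans)
    then show ?thesis
      by (auto simp: w_def intro!: frac_le)
  qed
  \<comment> \<open>Weights bounded below on \<open>L\<close> let the metric control the distances
    on all of \<open>L\<close>.\<close>
  have w_compact: "\<exists>e>0. \<forall>x \<in> L \<inter> ?I. w x \<ge> e" if L: "compactin X L" for L
  proof -
    obtain m where "L \<inter> ?I \<subseteq> (\<Union>n\<le>m. K n)"
      using isolated_Int_compact_absorbed[OF cover D L] by blast
    then show ?thesis
      using w_lower by (intro exI[of _ "1 / real (Suc m)"]) auto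
  qed
  \<comment> \<open>Conversely, off a compact set the weight alone keeps the truncated distance
    below \<open>e\<close>.\<close>
  have w_large: "\<exists>L. compactin X L \<and> {x \<in> ?I. w x \<ge> e} \<subseteq> L" if "e > 0" for e
  proof -
    obtain m where m: "1 / real (Suc m) < e"
      using nat_approx_posE[OF \<open>e > 0\<close>] by blast
    have "x \<in> (\<Union>n\<le>m. K n)" if x: "x \<in> ?I" "w x \<ge> e" for x
    proof -
      obtain n where n: "x \<in> K n" using x cover by blast
      have "1 / real (Suc m) < 1 / real (Suc (LEAST n. x \<in> K n))"
        using m x by (simp add: w_def)
      then have "(LEAST n. x \<in> K n) < m"
        by (simp add: field_simps)
      then show ?thesis
        using LeastI[of "\<lambda>n. x \<in> K n", OF n] less_imp_le by blast
    qed
    moreover have "compactin X (\<Union>n\<le>m. K n)"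
      using K by (intro compactin_Union) auto
    ultimately show ?thesis by blast
  qed

  \<comment> \<open>The weighted supremum metric\<close>
  define F where "F = topspace (Ck' X Y y0)"
  have F_in: "f x \<in> M" if "f \<in> F" "x \<in> topspace X" for f x
    using that unfolding F_def topspace_Ck'[OF y0] by (auto simp: top)
  have F_0: "f x = y0" if "f \<in> F" "x \<in> topspace X" "x \<notin> ?I" for f x
    using that unfolding F_def topspace_Ck'[OF y0] by (auto simp: nonisolated_points_def)
  have F_eq: "f = g" if "f \<in> F" "g \<in> F" "\<And>x. x \<in> ?I \<Longrightarrow> f x = g x" for f g
  proof (rule extensionalityI)
    show "f \<in> extensional (topspace X)" "g \<in> extensional (topspace X)"
      using that unfolding F_def topspace_Ck'[OF y0] by auto
    show "f x = g x" if "x \<in> topspace X" for x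
      using \<open>x \<in> topspace X\<close> \<open>f \<in> F\<close> \<open>g \<in> F\<close> F_0 \<open>\<And>x. x \<in> ?I \<Longrightarrow> f x = g x\<close> by metis
  qed
  have F_fin: "finite {x \<in> ?I \<inter> L. d y0 (f x) \<ge> e}" if "f \<in> F" "compactin X L" "e > 0" for f L e
  proof -
    have "closedin X {x \<in> ?I. f x \<notin> mball y0 e}"
      using that y0M unfolding F_def topspace_Ck'[OF y0] by (auto simp: top)
    then have "finite ({x \<in> ?I. f x \<notin> mball y0 e} \<inter> L)"
      using that by (intro finite_isolated_Int_compact) auto
    moreover have "{x \<in> ?I \<inter> L. d y0 (f x) \<ge> e} \<subseteq> {x \<in> ?I. f x \<notin> mball y0 e} \<inter> L"
      by auto
    ultimately show ?thesis
      using finite_subset by blast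
  qed

  \<comment> \<open>The weights are at most 1, which bounds the supremum, and \<open>ne\<close>
    makes its index set nonempty.\<close>
  define \<rho> where "\<rho> f g = (SUP x\<in>?I. min (w x) (d (f x) (g x)))" for f g
  have bdd: "bdd_above ((\<lambda>x. min (w x) (d (f x) (g x))) ` ?I)" for f g
    by (rule bdd_aboveI[of _ 1]) (auto simp: min_le_iff_disj w_le)
  have \<rho>_le: "\<rho> f g \<le> e \<longleftrightarrow> (\<forall>x \<in> ?I. min (w x) (d (f x) (g x)) \<le> e)" for f g e
    unfolding \<rho>_def by (rule cSUP_le_iff[OF ne bdd])
  have \<rho>_ge: "min (w x) (d (f x) (g x)) \<le> \<rho> f g" if "x \<in> ?I" for x f g
    using \<rho>_le[of f g "\<rho> f g"] that by blast
  have \<rho>_less: "d (f x) (g x) < e" if "\<rho> f g < e" "x \<in> ?I" "w x \<ge> e" for f g x e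
    using \<rho>_ge[of x f g] that by linarith

  interpret R: Metric_space F \<rho>
  proof
    show "0 \<le> \<rho> f g" for f g
    proof -
      obtain x where "x \<in> ?I" using ne by blast
      then show ?thesis
        using \<rho>_ge[of x f g] w_pos[of x] nonneg[of "f x" "g x"] by linarith
    qed
    then have nonneg\<rho>: "0 \<le> \<rho> f g" for f g .
    show "\<rho> f g = \<rho> g f" for f g
      by (simp add: \<rho>_def commute)
    show "\<rho> f g = 0 \<longleftrightarrow> f = g" if fg: "f \<in> F" "g \<in> F" for f g
    proof
      assume 0: "\<rho> f g = 0"
      show "f = g"
      proof (rule F_eq[OF fg])
        fix x assume x: "x \<in> ?I"
        then have "d (f x) (g x) \<le> 0"
          using \<rho>_ge[OF x, of f g] 0 w_pos[of x] by linarith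
        then show "f x = g x"
          using F_in fg x IX by (metis mdist_pos_less not_less subsetD)
      qed
    next
      assume "f = g"
      then have "\<rho> f g \<le> 0"
        unfolding \<rho>_le using F_in fg IX w_pos by (auto simp: min_le_iff_disj subset_iff)
      then show "\<rho> f g = 0"
        using nonneg\<rho>[of f g] by simp
    qed
    show "\<rho> f h \<le> \<rho> f g + \<rho> g h" if "f \<in> F" "g \<in> F" "h \<in> F" for f g h
      unfolding \<rho>_le
    proof
      fix x assume x: "x \<in> ?I"
      have "d (f x) (h x) \<le> d (f x) (g x) + d (g x) (h x)"
        using that F_in x IX by (intro triangle) auto
      then show "min (w x) (d (f x) (h x)) \<le> \<rho> f g + \<rho> g h"
        using \<rho>_ge[OF x, of f g] \<rho>_ge[OF x, of g h] nonneg\<rho>[of f g] nonneg\<rho>[of g h] by linarith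
    qed
  qed

  \<comment> \<open>Comparison of the metric topology with the compact-open topology\<close>
  have id_cont: "continuous_map R.mtopology (Ck' X Y y0) (\<lambda>f. f)"
  proof (rule continuous_map_into_Ck')
    show "(\<lambda>f. f) \<in> topspace R.mtopology \<rightarrow> topspace (Ck' X Y y0)"
      by (auto simp: F_def[symmetric])
    fix L U assume L: "compactin X L" and U: "openin Y U"
    have LX: "L \<subseteq> topspace X"
      using L compactin_subset_topspace by blast
    have "\<exists>r>0. R.mball f r \<subseteq> {f \<in> F. f ` L \<subseteq> U}" if f: "f \<in> F" "f ` L \<subseteq> U" for f
    proof -
      have "continuous_map X Y f"
        using f(1) unfolding F_def
        by (auto simp: Ck'_def topspace_compact_open_topology continuous_functions_def)
      then have "compactin mtopology (f ` L)"
        using image_compactin[OF L] top by blast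
      \<comment> \<open>The Lebesgue number of the one-set cover \<open>{U}\<close> is a margin that
        is uniform over the compact image.\<close>
      then obtain e where e: "e > 0" "\<And>x. x \<in> L \<Longrightarrow> mball (f x) e \<subseteq> U"
        using lebesgue_number[of "f ` L" "{U}"] f U top by auto
      obtain e' where e': "e' > 0" "\<And>x. x \<in> L \<inter> ?I \<Longrightarrow> w x \<ge> e'"
        using w_compact[OF L] by blast
      \<comment> \<open>A radius below the weights on \<open>L\<close> makes the minimum equal to
        the distance; at nonisolated points both functions are \<open>y0\<close>.\<close>
      have "g x \<in> U" if g: "g \<in> F" "\<rho> f g < min e e'" and x: "x \<in> L" for g x
      proof (cases "x \<in> ?I")
        case True
        have "d (f x) (g x) < min e e'"
          using True g x e' by (intro \<rho>_less) (auto simp: min_le_iff_disj)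
        then have "g x \<in> mball (f x) e"
          using f g F_in x LX by auto
        then show ?thesis using e x by blast
      next
        case False
        then have "g x = f x"
          using F_0 f g x LX by (metis subsetD)
        then show ?thesis using f x by auto
      qed
      then show ?thesis
        using e e' by (intro exI[of _ "min e e'"]) auto
    qed
    then show "openin R.mtopology {f \<in> topspace R.mtopology. f ` L \<subseteq> U}"
      unfolding R.openin_mtopology by auto
  qed

  have mball_nbhd: "\<exists>T. openin (Ck' X Y y0) T \<and> f \<in> T \<and> T \<subseteq> R.mball f r"
    if f: "f \<in> F" and r: "r > 0" for f r
  proof -
    obtain L where L: "compactin X L" "{x \<in> ?I. w x \<ge> r/2} \<subseteq> L"
      using w_large[of "r/2"] r by auto
    \<comment> \<open>On \<open>L - E\<close> the function \<open>f\<close> is within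
      \<open>r/4\<close> of \<open>y0\<close>, so the single condition \<open>T0\<close> keeps
      \<open>g\<close> within \<open>r/2\<close> of \<open>f\<close> there. The finitely many points
      of \<open>E\<close> get one condition each, and isolated points outside \<open>L\<close> have
      weight below \<open>r/2\<close>. Removing \<open>E\<close> keeps compactness because
      \<open>E\<close> is open.\<close>
    define E where "E = {x \<in> ?I \<inter> L. d y0 (f x) \<ge> r/4}"
    have E: "finite E" "E \<subseteq> ?I"
      unfolding E_def using F_fin[OF f L(1), of "r/4"] r by auto
    have "compactin X ((topspace X - E) \<inter> L)"
      using L(1) openin_isolated_subset[OF E(2)] by (intro closed_Int_compactin) auto
    moreover have "(topspace X - E) \<inter> L = L - E"
      using compactin_subset_topspace[OF L(1)] by blast
    ultimately have LE: "compactin X (L - E)"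
      by simp
    define T0 where "T0 = {g \<in> topspace (Ck' X Y y0). g ` (L - E) \<subseteq> mball y0 (r/4)}"
    define T1 where "T1 x = {g \<in> topspace (Ck' X Y y0). g ` {x} \<subseteq> mball (f x) (r/4)}" for x
    define T where "T = \<Inter> (insert T0 (T1 ` E))"
    have "openin (Ck' X Y y0) T"
      unfolding T_def
    proof (rule openin_Inter)
      fix S assume "S \<in> insert T0 (T1 ` E)"
      then consider "S = T0" | x where "x \<in> E" "S = T1 x" by blast
      then show "openin (Ck' X Y y0) S"
      proof cases
        case 1
        show ?thesis
          unfolding 1 T0_def by (rule openin_Ck'_subbase[OF LE]) (simp add: top)
      next
        case 2
        then have "x \<in> topspace X"
          using E IX by blast
        then show ?thesis
          unfolding 2 T1_def by (intro openin_Ck'_subbase) (auto simp: top)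
      qed
    qed (use E in auto)
    moreover have "f \<in> T"
    proof -
      have "f x \<in> mball y0 (r/4)" if x: "x \<in> L - E" for x
        using x f F_in F_0 compactin_subset_topspace[OF L(1)] y0M r
        by (cases "x \<in> ?I") (auto simp: E_def not_le)
      then have "f \<in> T0"
        using f by (auto simp: T0_def F_def)
      moreover have "f \<in> T1 x" if "x \<in> E" for x
        using f r F_in that E IX by (auto simp: T1_def F_def)
      ultimately show ?thesis
        by (auto simp: T_def)
    qed
    moreover have "T \<subseteq> R.mball f r"
    proof
      fix g assume g: "g \<in> T"
      then have gF: "g \<in> F" by (auto simp: T_def T0_def F_def)
      have "min (w x) (d (f x) (g x)) \<le> r/2" if x: "x \<in> ?I" for x
      proof (cases "w x \<ge> r/2")
        case True
        then have xL: "x \<in> L" using L x by auto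
        show ?thesis
        proof (cases "x \<in> E")
          case True
          then have "g \<in> T1 x" using g by (auto simp: T_def)
          then show ?thesis using r by (auto simp: T1_def)
        next
          case False
          then have "g x \<in> mball y0 (r/4)"
            using g xL by (auto simp: T_def T0_def)
          moreover have "d y0 (f x) < r/4"
            using False x xL by (auto simp: E_def)
          moreover have "f x \<in> M"
            using f F_in x IX by auto
          ultimately show ?thesis
            using triangle''[of "f x" y0 "g x"] by auto
        qed
      qed auto
      then have "\<rho> f g \<le> r/2"
        unfolding \<rho>_le by blast
      then show "g \<in> R.mball f r"
        using f gF r by simp
    qed
    ultimately show ?thesis by blast
  qed

  have "R.mtopology = Ck' X Y y0"
  proof (rule topology_eq[THEN iffD2], intro allI iffI)
    fix W assume W: "openin R.mtopology W"
    have WF: "W \<subseteq> F" and W_ball: "\<forall>f. f \<in> W \<longrightarrow> (\<exists>r>0. R.mball f r \<subseteq> W)"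
      using R.openin_mtopology[THEN iffD1, OF W] by (rule conjunct1, rule conjunct2)
    have "\<exists>T. openin (Ck' X Y y0) T \<and> f \<in> T \<and> T \<subseteq> W" if f: "f \<in> W" for f
    proof -
      obtain r where r: "r > 0" "R.mball f r \<subseteq> W"
        using W_ball f by auto
      obtain T where T: "openin (Ck' X Y y0) T" "f \<in> T" "T \<subseteq> R.mball f r"
        using mball_nbhd[OF subsetD[OF WF f] r(1)] by (elim exE conjE)
      show ?thesis
        by (intro exI[of _ T] conjI T(1,2) order_trans[OF T(3) r(2)])
    qed
    then show "openin (Ck' X Y y0) W"
      using openin_subopen[of "Ck' X Y y0" W] by simp
  next
    fix W assume W: "openin (Ck' X Y y0) W"
    then have "openin R.mtopology {f \<in> topspace R.mtopology. f \<in> W}"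
      using id_cont by (rule openin_continuous_map_preimage[rotated])
    moreover have "{f \<in> topspace R.mtopology. f \<in> W} = W"
      using openin_subset[OF W] by (auto simp: F_def[symmetric])
    ultimately show "openin R.mtopology W" by simp
  qed

  \<comment> \<open>Completeness of the weighted metric\<close>
  moreover have "R.mcomplete"
    unfolding R.mcomplete_def
  proof (intro allI impI)
    fix \<sigma> assume \<sigma>: "R.MCauchy \<sigma>"
    have \<sigma>F: "\<sigma> n \<in> F" for n
      using \<sigma> unfolding R.MCauchy_def by (elim conjE) (rule range_subsetD)
    have cau: "\<exists>N. \<forall>n\<ge>N. \<forall>m\<ge>N. \<rho> (\<sigma> n) (\<sigma> m) < e" if "e > 0" for e
    proof -
      obtain N where N: "\<forall>n m. N \<le> n \<longrightarrow> N \<le> m \<longrightarrow> \<rho> (\<sigma> n) (\<sigma> m) < e"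
        using \<sigma> \<open>e > 0\<close> unfolding R.MCauchy_def by presburger
      then show ?thesis
        by (intro exI[of _ N]) simp
    qed
    have "\<exists>y. limitin mtopology (\<lambda>n. \<sigma> n x) y sequentially" if x: "x \<in> ?I" for x
    proof -
      have "MCauchy (\<lambda>n. \<sigma> n x)"
        unfolding MCauchy_def
      proof (intro conjI allI impI)
        show "range (\<lambda>n. \<sigma> n x) \<subseteq> M"
          using \<sigma>F F_in x IX by auto
        fix e :: real assume "e > 0"
        then have "min e (w x) > 0"
          using w_pos by simp
        from cau[OF this] obtain N where N: "\<forall>n\<ge>N. \<forall>m\<ge>N. \<rho> (\<sigma> n) (\<sigma> m) < min e (w x)" ..
        have "d (\<sigma> n x) (\<sigma> m x) < e" if "N \<le> n" "N \<le> m" for n m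
        proof -
          have "d (\<sigma> n x) (\<sigma> m x) < min e (w x)"
            using N that x by (intro \<rho>_less) auto
          then show ?thesis by simp
        qed
        then show "\<exists>N. \<forall>n m. N \<le> n \<longrightarrow> N \<le> m \<longrightarrow> d (\<sigma> n x) (\<sigma> m x) < e"
          by blast
      qed
      then show ?thesis
        by (rule complete[unfolded mcomplete_def, rule_format])
    qed
    then have "\<forall>x \<in> ?I. \<exists>y. limitin mtopology (\<lambda>n. \<sigma> n x) y sequentially" by (rule ballI)
    from bchoice[OF this] obtain l
      where l': "\<forall>x \<in> ?I. limitin mtopology (\<lambda>n. \<sigma> n x) (l x) sequentially" ..
    have l: "limitin mtopology (\<lambda>n. \<sigma> n x) (l x) sequentially" if "x \<in> ?I" for x
      using l' that by (rule bspec)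
    have lM: "l x \<in> M" if "x \<in> ?I" for x
      using l[OF that] by (rule limitin_mspace)
    define f where "f = (\<lambda>x \<in> topspace X. if x \<in> ?I then l x else y0)"
    have fI: "f x = l x" if "x \<in> ?I" for x
      using that IX by (auto simp: f_def)
    \<comment> \<open>The index \<open>m\<close> goes to infinity in the Cauchy bound at a single
      \<open>x\<close>. The threshold \<open>N\<close> is the same for all \<open>x\<close>, so the
      bound passes to the supremum.\<close>
    have conv: "min (w x) (d (f x) (\<sigma> n x)) \<le> e"
      if N: "\<forall>n\<ge>N. \<forall>m\<ge>N. \<rho> (\<sigma> n) (\<sigma> m) < e" and n: "n \<ge> N" and x: "x \<in> ?I"
      for N e n x
    proof (rule field_le_epsilon)
      fix u :: real assume "u > 0"
      then have "\<forall>\<^sub>F m in sequentially. \<sigma> m x \<in> M \<and> d (\<sigma> m x) (l x) < u"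
        using l[OF x] unfolding limitin_metric by blast
      then obtain N' where N': "\<forall>m \<ge> N'. \<sigma> m x \<in> M \<and> d (\<sigma> m x) (l x) < u"
        unfolding eventually_sequentially ..
      define m where "m = max N N'"
      have m: "m \<ge> N" "\<sigma> m x \<in> M" "d (\<sigma> m x) (l x) < u"
        using N' by (auto simp: m_def)
      have "d (l x) (\<sigma> n x) \<le> d (\<sigma> m x) (l x) + d (\<sigma> m x) (\<sigma> n x)"
        using m lM x F_in \<sigma>F IX by (intro triangle'') auto
      then show "min (w x) (d (f x) (\<sigma> n x)) \<le> e + u"
        unfolding fI[OF x]
        using \<rho>_ge[OF x, of "\<sigma> m" "\<sigma> n"] N[rule_format, OF m(1) n] m(3) \<open>u > 0\<close>
        by linarith
    qed
    have "f \<in> F"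
      unfolding F_def topspace_Ck'[OF y0]
    proof (intro conjI allI impI ballI)
      show "f \<in> topspace X \<rightarrow> topspace Y"
        using lM y0M by (auto simp: f_def top)
      fix U assume U: "openin Y U \<and> y0 \<in> U"
      then obtain e where e: "e > 0" "mball y0 e \<subseteq> U"
        unfolding top openin_mtopology by blast
      let ?E = "{x \<in> ?I. f x \<notin> U}"
      \<comment> \<open>By the choice of the \<open>K n\<close> this finiteness makes
        \<open>?E\<close> closed. It is inherited from one term \<open>\<sigma> N\<close> close to
        \<open>f\<close> on \<open>K n\<close>: where \<open>f\<close> is at least \<open>e\<close>
        away from \<open>y0\<close>, that term is at least \<open>e/2\<close> away.\<close>
      have "finite (?E \<inter> K n)" for n
      proof -
        obtain v where v: "v > 0" "\<And>x. x \<in> K n \<inter> ?I \<Longrightarrow> w x \<ge> v"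
          using w_compact[OF K] by blast
        \<comment> \<open>Strictly below \<open>v\<close>, so that in \<open>conv\<close> the
          distance and not the weight is bounded by \<open>u\<close>; at most \<open>e/2\<close> for
          the triangle inequality.\<close>
        define u where "u = min (v/2) (e/2)"
        have u: "u > 0" "u < v" "u \<le> e/2"
          using v e by (auto simp: u_def)
        from cau[OF u(1)] obtain N where N: "\<forall>n\<ge>N. \<forall>m\<ge>N. \<rho> (\<sigma> n) (\<sigma> m) < u" ..
        have "?E \<inter> K n \<subseteq> {x \<in> ?I \<inter> K n. d y0 (\<sigma> N x) \<ge> e/2}"
        proof
          fix x assume x: "x \<in> ?E \<inter> K n"
          then have "w x \<ge> v" using v by auto
          then have "d (f x) (\<sigma> N x) \<le> u"
            using conv[OF N, of N x] x u by auto
          moreover have "f x \<in> M" "\<sigma> N x \<in> M"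
            using x fI lM F_in \<sigma>F IX by auto
          moreover have "d y0 (f x) \<ge> e"
            using x e y0M \<open>f x \<in> M\<close> by (auto simp: subset_iff not_less)
          ultimately have "d y0 (\<sigma> N x) \<ge> e/2"
            using triangle[of y0 "\<sigma> N x" "f x"] commute[of "f x" "\<sigma> N x"] y0M u by auto
          then show "x \<in> {x \<in> ?I \<inter> K n. d y0 (\<sigma> N x) \<ge> e/2}"
            using x by auto
        qed
        moreover have "finite {x \<in> ?I \<inter> K n. d y0 (\<sigma> N x) \<ge> e/2}"
          by (rule F_fin[OF \<sigma>F K]) (use e in simp)
        ultimately show ?thesis
          by (rule finite_subset)
      qed
      then show "closedin X ?E"
        using D[of ?E] by blast
    qed (auto simp: f_def nonisolated_points_def)
    moreover have "\<forall>\<^sub>F n in sequentially. \<sigma> n \<in> F \<and> \<rho> (\<sigma> n) f < e" if e: "e > 0" for e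
    proof -
      have "e/2 > 0"
        using e by simp
      from cau[OF this] obtain N where N: "\<forall>n\<ge>N. \<forall>m\<ge>N. \<rho> (\<sigma> n) (\<sigma> m) < e/2" ..
      have "\<rho> (\<sigma> n) f \<le> e/2" if "n \<ge> N" for n
        unfolding \<rho>_le using conv[OF N that] by (simp add: commute)
      moreover have "e/2 < e"
        using e by simp
      ultimately have "\<forall>n\<ge>N. \<sigma> n \<in> F \<and> \<rho> (\<sigma> n) f < e"
        using \<sigma>F by fastforce
      then show ?thesis
        unfolding eventually_sequentially ..
    qed
    ultimately have "limitin R.mtopology \<sigma> f sequentially"
      unfolding R.limitin_metric by simp
    then show "\<exists>f. limitin R.mtopology \<sigma> f sequentially"
      by (intro exI[of _ f])
  qed
  ultimately show ?thesis
    using R.completely_metrizable_space_mtopology by simp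
qed

section \<open>The equivalence for an arbitrary target and for the two-point space\<close>

lemma completely_metrizable_Ck'_iff:
  assumes y0: "y0 \<in> topspace Y" and b: "b \<in> topspace Y" "b \<noteq> y0"
    and ne: "isolated_points X \<noteq> {}"
  shows "completely_metrizable_space (Ck' X Y y0) \<longleftrightarrow>
         completely_metrizable_space Y \<and> dot_kappa_omega_space X"
proof
  assume cm: "completely_metrizable_space (Ck' X Y y0)"
  obtain a where "a \<in> isolated_points X" using ne by blast
  \<comment> \<open>The target comes first, since its metrizability supplies the Hausdorff property
    for the other half.\<close>
  then have Y: "completely_metrizable_space Y"
    by (rule completely_metrizable_space_retraction_map_image[OF retraction_map_Ck'_eval[OF y0] cm])
  then have "Hausdorff_space Y"
    by (simp add: completely_metrizable_imp_metrizable_space metrizable_imp_Hausdorff_space)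
  from Y completely_metrizable_Ck'_imp_dot_kappa_omega[OF cm this y0 b]
  show "completely_metrizable_space Y \<and> dot_kappa_omega_space X" ..
next
  assume "completely_metrizable_space Y \<and> dot_kappa_omega_space X"
  then show "completely_metrizable_space (Ck' X Y y0)"
    using dot_kappa_omega_imp_completely_metrizable_Ck'[OF _ y0 _ ne] by simp
qed

theorem theorem8p1:
  fixes X :: "'a topology" and Y :: "'b topology" and y0 :: 'b
  assumes "y0 \<in> topspace Y"
    and "\<exists>a \<in> topspace Y. \<exists>b \<in> topspace Y. a \<noteq> b"
    and "isolated_points X \<noteq> {}"
  shows "(completely_metrizable_space (Ck' X Y y0) \<longleftrightarrow>
            completely_metrizable_space Y \<and>
            completely_metrizable_space (Ck' X (discrete_topology {0, 1 :: nat}) 0)) \<and>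
         (completely_metrizable_space Y \<and>
            completely_metrizable_space (Ck' X (discrete_topology {0, 1 :: nat}) 0) \<longleftrightarrow>
            completely_metrizable_space Y \<and> dot_kappa_omega_space X)"
proof -
  obtain b where "b \<in> topspace Y" "b \<noteq> y0"
    using assms(2) by metis
  then have "completely_metrizable_space (Ck' X Y y0) \<longleftrightarrow>
      completely_metrizable_space Y \<and> dot_kappa_omega_space X"
    by (rule completely_metrizable_Ck'_iff[OF assms(1) _ _ assms(3)])
  \<comment> \<open>The discrete target is itself completely metrizable, so the equivalence leaves
    only the condition on \<open>X\<close>.\<close>
  moreover have "completely_metrizable_space (Ck' X (discrete_topology {0, 1 :: nat}) 0) \<longleftrightarrow>
      dot_kappa_omega_space X"
    using completely_metrizable_Ck'_iff[of 0 "discrete_topology {0, 1 :: nat}" 1 X] assms(3)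
    by (simp add: completely_metrizable_space_discrete_topology)
  ultimately show ?thesis by blast
qed

end
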